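(* Let $L,d\ge 1$ be integers, and for each $k\in\{1,\dots,L\}$ let $f_k:\mathbb{R}^d\to\mathbb{R}^d$ be a map and $W_k,\Delta W_k'\in\mathbb{R}^{d\times d}$ matrices. For each $t\in\{1,\dots,L\}$ let $h_t\in\{1,\dots,L\}$ be a block index, and let $\alpha\in[0,1]$. Consider the MoLEx update over $L$ blocks $$z_{t+1}=z_t+\alpha f_t\big((W_t+\Delta W_t')z_t\big)+(1-\alpha)f_{h_t}\big((W_{h_t}+\Delta W_{h_t}')z_t\big),\qquad t=1,\dots,L,$$ and, for controls $g_1,\dots,g_L:\mathbb{R}^d\to\mathbb{R}^d$, the generalized state-based update $$x_{t+1}=x_t+f_t(W_tx_t)+\alpha\,g_t(x_t)+(1-\alpha)\,g_{h_t}(x_t),\qquad t=1,\dots,L.$$ Assume that $\alpha>\tfrac12$ and $z_1=x_1$. Then there exist controls $g_k:\mathbb{R}^d\to\mathbb{R}^d$, $k=1,\dots,L$, such that: (i) when the $f_k$ are linear, $z_t=x_t$ for all $t\in\{1,\dots,L+1\}$; (ii) when the $f_k$ are smooth nonlinear maps and the perturbations are small, i.e. $\|\Delta W_t'\|<\xi$ for all $t$ with $\xi>0$ sufficiently small, $\mathbb{E}\big[\|z_t-x_t\|^2\big]$ is bounded and tends to $0$ as $\xi\to0$.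
   Context: $z_t$ and $x_t$ denote the outputs (states in $\mathbb{R}^d$) at block $t$ of the two systems. $W_t$ is the frozen pretrained weight of block $t$, $\Delta W_t'$ is the weight perturbation (adapter) used by MoLEx at block $t$, $h_t$ is the index of the other block with which block $t$ communicates ($h_t=t$ is allowed), and $\alpha$ balances local and cross-block information. $g_t$ is the control attached to block $t$; the same family $g_1,\dots,g_L$ is used both as local controls ($g_t$) and as cross-block controls ($g_{h_t}$). $\|\cdot\|$ is the Euclidean norm for vectors and the operator norm for matrices. The common initial state $z_1=x_1$ is random (drawn from the data distribution), and $\mathbb{E}$ is the expectation over it. *)

theory Defs
  imports "HOL-Probability.Probability"
begin

text \<open>
  States are indexed from 1: \<open>trajectory F s t\<close> is the state at index \<open>t\<close> of
  \<open>x (t + 1) = F t (x t)\<close> for \<open>t \<ge> 1\<close> with \<open>x 1 = s\<close>. The value at index 0 is a dummy.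
\<close>

primrec trajectory :: "(nat \<Rightarrow> 'a \<Rightarrow> 'a) \<Rightarrow> 'a \<Rightarrow> nat \<Rightarrow> 'a" where
  "trajectory F s 0 = s"
| "trajectory F s (Suc t) = (if t = 0 then s else F t (trajectory F s t))"

lemma trajectory_1: "trajectory F s 1 = s"
  by simp

lemma trajectory_step: "t \<ge> 1 \<Longrightarrow> trajectory F s (t + 1) = F t (trajectory F s t)"
  by simp

definition molex_step ::
  "(nat \<Rightarrow> real ^ 'd \<Rightarrow> real ^ 'd) \<Rightarrow> (nat \<Rightarrow> real ^ 'd ^ 'd) \<Rightarrow> (nat \<Rightarrow> real ^ 'd ^ 'd) \<Rightarrow>
   (nat \<Rightarrow> nat) \<Rightarrow> real \<Rightarrow> nat \<Rightarrow> real ^ 'd \<Rightarrow> real ^ 'd" where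
  "molex_step f W \<Delta>W h \<alpha> t z =
     z + \<alpha> *\<^sub>R f t ((W t + \<Delta>W t) *v z)
       + (1 - \<alpha>) *\<^sub>R f (h t) ((W (h t) + \<Delta>W (h t)) *v z)"

definition control_step ::
  "(nat \<Rightarrow> real ^ 'd \<Rightarrow> real ^ 'd) \<Rightarrow> (nat \<Rightarrow> real ^ 'd ^ 'd) \<Rightarrow>
   (nat \<Rightarrow> real ^ 'd \<Rightarrow> real ^ 'd) \<Rightarrow> (nat \<Rightarrow> nat) \<Rightarrow> real \<Rightarrow> nat \<Rightarrow> real ^ 'd \<Rightarrow> real ^ 'd" where
  "control_step f W g h \<alpha> t x =
     x + f t (W t *v x) + \<alpha> *\<^sub>R g t x + (1 - \<alpha>) *\<^sub>R g (h t) x"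

definition molex_state where
  "molex_state f W \<Delta>W h \<alpha> = trajectory (molex_step f W \<Delta>W h \<alpha>)"

definition control_state where
  "control_state f W g h \<alpha> = trajectory (control_step f W g h \<alpha>)"

text \<open>The operator norm; the type class norm on matrices is the Frobenius norm.\<close>

definition op_norm :: "real ^ 'd ^ 'd \<Rightarrow> real" where
  "op_norm A = onorm (\<lambda>x. A *v x)"

text \<open>
  \<open>C_k n f\<close>: \<open>f\<close> is \<open>n\<close> times continuously differentiable on the whole space, expressed by all
  directional derivatives being \<open>n - 1\<close> times continuously differentiable.
\<close>

primrec C_k ::
  "nat \<Rightarrow> ('a::euclidean_space \<Rightarrow> 'b::real_normed_vector) \<Rightarrow> bool" where
  "C_k 0 f \<longleftrightarrow> continuous_on UNIV f"
| "C_k (Suc n) f \<longleftrightarrow>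
     (\<forall>x. f differentiable (at x)) \<and> (\<forall>v. C_k n (\<lambda>x. frechet_derivative f (at x) v))"

definition smooth :: "('a::euclidean_space \<Rightarrow> 'b::real_normed_vector) \<Rightarrow> bool" where
  "smooth f \<longleftrightarrow> (\<forall>n. C_k n f)"

end

theory Submission
  imports Defs
begin

text \<open>
  The two systems coincide exactly if, pointwise in \<open>x\<close>, the controls solve the linear system
  \<open>\<alpha> g\<^sub>t + (1 - \<alpha>) g\<^bsub>h t\<^esub> = u\<^sub>t\<close> with
  \<open>u\<^sub>t\<close> the difference of the uncontrolled updates. For \<open>\<alpha> > 1/2\<close> its matrix is strictly
  diagonally dominant, so the Neumann series solves it. This works for arbitrary maps \<open>f\<^sub>k\<close>, so
  the bound in the nonlinear case holds with \<open>B = 0\<close>.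
\<close>

text \<open>Solving the equation at \<open>t\<close> for \<open>v t\<close> gives
  \<open>v t = (1 / \<alpha>) *\<^sub>R u t + r *\<^sub>R v (h t)\<close> with
  \<open>r = - ((1 - \<alpha>) / \<alpha>)\<close>; unrolling this along the \<open>h\<close>-orbit
  of \<open>t\<close> produces the series \<open>c t\<close>.\<close>

lemma cross_block_system_solvable:
  fixes u :: "'i \<Rightarrow> 'a::banach" and \<alpha> :: real
  assumes "finite A" and h: "\<And>t. t \<in> A \<Longrightarrow> h t \<in> A" and \<alpha>: "1 / 2 < \<alpha>" "\<alpha> \<le> 1"
  shows "\<exists>v. \<forall>t\<in>A. \<alpha> *\<^sub>R v t + (1 - \<alpha>) *\<^sub>R v (h t) = u t"
proof -
  define r where "r = - ((1 - \<alpha>) / \<alpha>)"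
  define c where "c t n = r ^ n *\<^sub>R u ((h ^^ n) t)" for t n
  define v where "v t = (1 / \<alpha>) *\<^sub>R suminf (c t)" for t
  \<comment> \<open>This is where \<alpha> > 1/2 enters: it says 1 - \<alpha> < \<alpha>.\<close>
  have r: "\<bar>r\<bar> < 1"
    using \<alpha> by (auto simp: r_def field_simps)
  have orbit: "(h ^^ n) t \<in> A" if "t \<in> A" for t n
    using that h by (induction n) auto
  \<comment> \<open>The orbit stays in the finite set \<open>A\<close>, so the sum of all
    \<open>norm (u k)\<close> bounds every coefficient and a geometric series dominates.\<close>
  have summable_c: "summable (c t)" if t: "t \<in> A" for t
  proof (rule summable_comparison_test')
    show "summable (\<lambda>n. (\<Sum>k\<in>A. norm (u k)) * \<bar>r\<bar> ^ n)"
      using r by (intro summable_mult summable_geometric) simp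
    fix n
    have "norm (u ((h ^^ n) t)) \<le> (\<Sum>k\<in>A. norm (u k))"
      using orbit[OF t] \<open>finite A\<close> by (intro member_le_sum) auto
    then show "norm (c t n) \<le> (\<Sum>k\<in>A. norm (u k)) * \<bar>r\<bar> ^ n"
      by (simp add: c_def power_abs mult.commute mult_left_mono)
  qed
  have "\<alpha> *\<^sub>R v t + (1 - \<alpha>) *\<^sub>R v (h t) = u t" if t: "t \<in> A" for t
  proof -
    \<comment> \<open>The orbit of \<open>h t\<close> is that of \<open>t\<close> without its first
      point, so the tail of the series at \<open>t\<close> is \<open>r\<close> times the series at
      \<open>h t\<close>.\<close>
    have shift: "c t (Suc n) = r *\<^sub>R c (h t) n" for n
      by (simp add: c_def funpow_swap1)
    have "suminf (c t) = c t 0 + (\<Sum>n. c t (Suc n))"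
      using suminf_split_head[OF summable_c[OF t]] by simp
    also have "\<dots> = u t + r *\<^sub>R suminf (c (h t))"
      unfolding shift suminf_scaleR_right[OF summable_c[OF h[OF t]], symmetric]
      by (simp add: c_def[of t 0])
    finally show ?thesis
      using \<alpha> by (simp add: v_def r_def)
  qed
  then show ?thesis by blast
qed

text \<open>State \<open>n\<close> is built from steps 1 to \<open>n - 1\<close> only, so agreement
  on blocks 1 to \<open>L\<close> reaches state \<open>L + 1\<close>.\<close>

lemma trajectory_eqI:
  assumes "\<And>t x. 1 \<le> t \<Longrightarrow> t < n \<Longrightarrow> F t x = G t x"
  shows "trajectory F s n = trajectory G s n"
  using assms by (induction n) auto

lemma exact_controls_exist:
  fixes f :: "nat \<Rightarrow> real ^ 'd \<Rightarrow> real ^ 'd"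
  assumes "\<And>t. t \<in> {1..L} \<Longrightarrow> h t \<in> {1..L}" "1 / 2 < \<alpha>" "\<alpha> \<le> 1"
  shows "\<exists>g. \<forall>s. \<forall>t\<in>{1..L + 1}. molex_state f W \<Delta>W h \<alpha> s t = control_state f W g h \<alpha> s t"
proof -
  \<comment> \<open>The system is solved separately at each point \<open>x\<close> of the state
    space, so the resulting controls do not depend on the initial state \<open>s\<close>.\<close>
  have "\<exists>v. \<forall>t\<in>{1..L}. \<alpha> *\<^sub>R v t + (1 - \<alpha>) *\<^sub>R v (h t)
      = molex_step f W \<Delta>W h \<alpha> t x - x - f t (W t *v x)" for x
    using assms by (intro cross_block_system_solvable) auto
  then obtain v where v: "\<And>x t. t \<in> {1..L} \<Longrightarrow> \<alpha> *\<^sub>R v x t + (1 - \<alpha>) *\<^sub>R v x (h t)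
      = molex_step f W \<Delta>W h \<alpha> t x - x - f t (W t *v x)"
    by metis
  have "molex_step f W \<Delta>W h \<alpha> t x = control_step f W (\<lambda>k y. v y k) h \<alpha> t x"
    if "t \<in> {1..L}" for t x
    using v[OF that, of x] by (simp add: control_step_def algebra_simps)
  then have "molex_state f W \<Delta>W h \<alpha> s t = control_state f W (\<lambda>k y. v y k) h \<alpha> s t"
    if "t \<in> {1..L + 1}" for s t
    unfolding molex_state_def control_state_def using that by (intro trajectory_eqI) auto
  then show ?thesis by blast
qed

theorem theorem4p1:
  fixes L :: nat
    and f :: "nat \<Rightarrow> real ^ 'd \<Rightarrow> real ^ 'd"
    and W :: "nat \<Rightarrow> real ^ 'd ^ 'd"
    and h :: "nat \<Rightarrow> nat"
    and \<alpha> :: real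
    and D :: "(real ^ 'd) measure"
  assumes "L \<ge> 1"
    and "\<forall>t\<in>{1..L}. h t \<in> {1..L}"
    and "0 \<le> \<alpha>" "\<alpha> \<le> 1"
    and "\<alpha> > 1 / 2"
    and "prob_space D" "sets D = sets borel"
  shows "\<exists>g :: (nat \<Rightarrow> real ^ 'd ^ 'd) \<Rightarrow> nat \<Rightarrow> real ^ 'd \<Rightarrow> real ^ 'd.
    ((\<forall>k\<in>{1..L}. linear (f k)) \<longrightarrow>
      (\<forall>\<Delta>W s. \<forall>t\<in>{1..L + 1}.
         molex_state f W \<Delta>W h \<alpha> s t = control_state f W (g \<Delta>W) h \<alpha> s t)) \<and>
    ((\<forall>k\<in>{1..L}. smooth (f k)) \<longrightarrow>
      (\<exists>\<xi>\<^sub>0>0. \<exists>B :: real \<Rightarrow> real.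
         bounded (B ` {0<..<\<xi>\<^sub>0}) \<and> (B \<longlongrightarrow> 0) (at_right 0) \<and>
         (\<forall>\<xi>\<in>{0<..<\<xi>\<^sub>0}. \<forall>\<Delta>W. (\<forall>k\<in>{1..L}. op_norm (\<Delta>W k) < \<xi>) \<longrightarrow>
            (\<forall>t\<in>{1..L + 1}.
               integrable D (\<lambda>s. (norm (molex_state f W \<Delta>W h \<alpha> s t
                                        - control_state f W (g \<Delta>W) h \<alpha> s t))\<^sup>2) \<and>
               prob_space.expectation D (\<lambda>s. (norm (molex_state f W \<Delta>W h \<alpha> s t
                                        - control_state f W (g \<Delta>W) h \<alpha> s t))\<^sup>2) \<le> B \<xi>))))"
proof -
  have "\<exists>g. \<forall>s. \<forall>t\<in>{1..L + 1}. molex_state f W \<Delta>W h \<alpha> s t = control_state f W g h \<alpha> s t"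
    for \<Delta>W
    using assms by (intro exact_controls_exist) auto
  then obtain g where g: "\<And>\<Delta>W s t. t \<in> {1..L + 1} \<Longrightarrow>
      molex_state f W \<Delta>W h \<alpha> s t = control_state f W (g \<Delta>W) h \<alpha> s t"
    by metis
  show ?thesis
  proof (intro exI[of _ g] conjI impI)
    show "\<forall>\<Delta>W s. \<forall>t\<in>{1..L + 1}.
        molex_state f W \<Delta>W h \<alpha> s t = control_state f W (g \<Delta>W) h \<alpha> s t"
      using g by blast
  \<comment> \<open>The integrand vanishes identically, so any positive threshold serves, here
    1.\<close>
  qed (intro exI[of _ "1 :: real"] exI[of _ "\<lambda>_. 0 :: real"],
      auto simp: g bounded_iff)
qed

end
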